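(* Let $p\ge 0$ be a given dimension. Let $G_1=(V,E_1)$ and $G_2=(V,E_2)$ be two unweighted graphs with the same vertex set $V$, and let $P_1$ and $P_2$ be the persistence diagrams of dimension $p$ corresponding to $G_1$ and $G_2$ respectively, computed using the clique complex filtration. Then the bottleneck distance $B$ between $P_1$ and $P_2$ is not bounded above by a constant times the distance $D^U$ between the graphs $G_1$ and $G_2$; that is, $B(P_1,P_2)\nleq \alpha\, D^U(G_1,G_2)$ for a constant $\alpha$. In other words, for the given $p$ there is no real constant $\alpha$ such that $B(P_1,P_2)\le\alpha\,D^U(G_1,G_2)$ holds for all such pairs of graphs $G_1,G_2$ on a common vertex set.
   Context: Graphs are finite, undirected and unweighted. For two graphs on the same vertex set $V$, $D^U((V,E_1),(V,E_2))=\max_{i,j\in V}|\mathbb{1}_{E_1}((i,j))-\mathbb{1}_{E_2}((i,j))|\in\{0,1\}$, where $\mathbb{1}_E$ is the indicator function of the edge set $E$. A clique of a graph is a set of vertices in which every two distinct vertices are adjacent. The clique complex of $G$ is the abstract simplicial complex in which each clique of size $k$ of $G$ ($k\ge1$) corresponds to a $(k-1)$-simplex. The clique complex filtration of $G$ is $\emptyset\subset K_0\subset K_1\subset\dots\subset K_m$, where $K_i$ is the $i$-skeleton of the clique complex $K$ of $G$ (the subcomplex of all simplices of dimension at most $i$) and $m=\dim K$. Homology is simplicial homology with coefficients in a given field. The $p$-dimensional persistence diagram of a filtration is the multiset of points $(i,j)$, one for each element of the $p$-homology that is born at $K_i$ and dies at $K_j$ (filtration indices are the coordinates); an element that never dies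 has $j=\infty$. The bottleneck distance is $B(X,Y)=\inf_{\eta}\sup_{x\in X}\|x-\eta(x)\|_\infty$, where all diagonal points $(a,a)$, each with infinite multiplicity, are first added to both diagrams, and $\eta$ ranges over bijections $X\to Y$. By the usual convention $|\infty-\infty|=0$ and $|\infty-a|=\infty$ for finite $a$, so $B$ may take the value $\infty$. *)

theory Defs
  imports
    "HOL-Library.Extended_Real"
    "HOL-Library.Indicator_Function"
    "HOL-Library.Multiset"
    "HOL-Library.Poly_Mapping"
    "HOL-Algebra.AbelCoset"
    "HOL-Algebra.Module"
    "Graph_Theory.Pair_Digraph"
    "Jordan_Normal_Form.VS_Connect"
begin

hide_const (open) Multiset.mult Polynomial.smult Modules.module

section \<open>Graphs\<close>

text \<open>A finite simple undirected graph is a \<^locale>\<open>pair_graph\<close>: a finite vertex set with a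
  symmetric irreflexive set of arcs, so that an edge is present as both of its ordered pairs.\<close>

definition graph_distance :: "'v pair_pre_digraph \<Rightarrow> 'v pair_pre_digraph \<Rightarrow> real" where
  "graph_distance G H =
     Max ((\<lambda>(i, j). \<bar>indicat_real (parcs G) (i, j) - indicat_real (parcs H) (i, j)\<bar>)
            ` (pverts G \<times> pverts G))"

definition clique :: "'v pair_pre_digraph \<Rightarrow> 'v set \<Rightarrow> bool" where
  "clique G S \<longleftrightarrow> S \<subseteq> pverts G \<and> (\<forall>u\<in>S. \<forall>v\<in>S. u \<noteq> v \<longrightarrow> (u, v) \<in> parcs G)"


section \<open>Simplicial complexes\<close>

text \<open>An abstract simplicial complex is the set of its simplices, which are finite nonempty
  vertex sets; a simplex of cardinality \<open>n + 1\<close> has dimension \<open>n\<close>.\<close>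

definition clique_complex :: "'v pair_pre_digraph \<Rightarrow> 'v set set" where
  "clique_complex G = {S. finite S \<and> S \<noteq> {} \<and> clique G S}"

definition skeleton :: "nat \<Rightarrow> 'v set set \<Rightarrow> 'v set set" where
  "skeleton i K = {S \<in> K. card S \<le> i + 1}"

definition complex_dim :: "'v set set \<Rightarrow> nat" where
  "complex_dim K = Max ((\<lambda>S. card S - 1) ` K)"


section \<open>Simplicial homology with field coefficients\<close>

text \<open>Each simplex is oriented by the order of the vertex type. Chains are formal linear
  combinations of simplices.\<close>

definition chain_space :: "nat \<Rightarrow> 'v set set \<Rightarrow> ('k::field, 'v set \<Rightarrow>\<^sub>0 'k) module" where
  "chain_space n K =
     \<lparr> carrier = {c. Poly_Mapping.keys c \<subseteq> {S \<in> K. card S = n + 1}},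
       mult = undefined, one = undefined, zero = 0, add = (+),
       smult = (\<lambda>a. Poly_Mapping.map ((*) a)) \<rparr>"

text \<open>If \<open>v\<close> is the vertex of \<open>S\<close> with position \<open>i\<close> (counted from 0) in increasing order, then
  \<open>i = card {u \<in> S. u < v}\<close>. The boundary of a 0-chain is 0 (homology is not reduced).\<close>

definition boundary ::
  "nat \<Rightarrow> ('v::linorder set \<Rightarrow>\<^sub>0 'k::field) \<Rightarrow> ('v set \<Rightarrow>\<^sub>0 'k)" where
  "boundary n c =
     (if n = 0 then 0
      else \<Sum>S\<in>Poly_Mapping.keys c. \<Sum>v\<in>S.
             Poly_Mapping.single (S - {v})
               ((- 1) ^ card {u \<in> S. u < v} * Poly_Mapping.lookup c S))"

definition cycle_space ::
  "nat \<Rightarrow> 'v::linorder set set \<Rightarrow> ('k::field, 'v set \<Rightarrow>\<^sub>0 'k) module" where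
  "cycle_space n K =
     (chain_space n K) \<lparr> carrier := {c \<in> carrier (chain_space n K). boundary n c = 0} \<rparr>"

definition boundaries :: "nat \<Rightarrow> 'v::linorder set set \<Rightarrow> ('v set \<Rightarrow>\<^sub>0 'k::field) set" where
  "boundaries n K = boundary (n + 1) ` carrier (chain_space (n + 1) K)"

text \<open>The quotient of a module by a submodule, built from cosets as \<^const>\<open>A_FactGroup\<close> is.\<close>

definition quotient_module :: "('a, 'b) module \<Rightarrow> 'b set \<Rightarrow> ('a, 'b set) module" where
  "quotient_module M N =
     \<lparr> carrier = a_rcosets\<^bsub>M\<^esub> N, mult = undefined, one = undefined, zero = N, add = set_add M,
       smult = (\<lambda>a X. \<Union>x\<in>X. N +>\<^bsub>M\<^esub> (a \<odot>\<^bsub>M\<^esub> x)) \<rparr>"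

definition homology ::
  "nat \<Rightarrow> 'v::linorder set set \<Rightarrow> ('k::field, ('v set \<Rightarrow>\<^sub>0 'k) set) module" where
  "homology n K = quotient_module (cycle_space n K) (boundaries n K)"

text \<open>The map from the homology of \<open>K\<close> to that of \<open>L\<close> induced by an inclusion \<open>K \<subseteq> L\<close> of
  complexes sends the class of a cycle in \<open>K\<close> to the class of the same cycle in \<open>L\<close>.\<close>

definition homology_inclusion ::
  "nat \<Rightarrow> 'v::linorder set set \<Rightarrow> ('v set \<Rightarrow>\<^sub>0 'k::field) set \<Rightarrow> ('v set \<Rightarrow>\<^sub>0 'k) set" where
  "homology_inclusion n L X = (\<Union>x\<in>X. boundaries n L +>\<^bsub>cycle_space n L\<^esub> x)"

definition persistent_homology ::
  "nat \<Rightarrow> 'v::linorder set set \<Rightarrow> 'v set set \<Rightarrow> ('k::field, ('v set \<Rightarrow>\<^sub>0 'k) set) module" where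
  "persistent_homology n K L =
     (homology n L) \<lparr> carrier :=
        homology_inclusion n L ` carrier (homology n K :: ('k, ('v set \<Rightarrow>\<^sub>0 'k) set) module) \<rparr>"

definition persistent_betti ::
  "'k::field itself \<Rightarrow> nat \<Rightarrow> 'v::linorder set set \<Rightarrow> 'v set set \<Rightarrow> nat" where
  "persistent_betti _ n K L =
     vectorspace.dim (class_ring :: 'k ring) (persistent_homology n K L)"


section \<open>Persistence diagrams\<close>

text \<open>A filtration \<open>F 0 \<subseteq> \<dots> \<subseteq> F m\<close> of complexes is extended by the empty complex below index 0.\<close>

definition filtration_before :: "(nat \<Rightarrow> 'v set set) \<Rightarrow> nat \<Rightarrow> 'v set set" where
  "filtration_before F i = (if i = 0 then {} else F (i - 1))"

text \<open>The number of independent classes that are alive at \<open>F i\<close>, not yet present at \<open>F (i - 1)\<close>,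
  still alive at \<open>F (j - 1)\<close> and dead at \<open>F j\<close>.\<close>

definition finite_multiplicity ::
  "'k::field itself \<Rightarrow> nat \<Rightarrow> (nat \<Rightarrow> 'v::linorder set set) \<Rightarrow> nat \<Rightarrow> nat \<Rightarrow> nat" where
  "finite_multiplicity k n F i j =
     nat ((int (persistent_betti k n (F i) (filtration_before F j))
             - int (persistent_betti k n (F i) (F j)))
        - (int (persistent_betti k n (filtration_before F i) (filtration_before F j))
             - int (persistent_betti k n (filtration_before F i) (F j))))"

definition infinite_multiplicity ::
  "'k::field itself \<Rightarrow> nat \<Rightarrow> (nat \<Rightarrow> 'v::linorder set set) \<Rightarrow> nat \<Rightarrow> nat \<Rightarrow> nat" where
  "infinite_multiplicity k n F m i =
     nat (int (persistent_betti k n (F i) (F m))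
        - int (persistent_betti k n (filtration_before F i) (F m)))"

definition persistence_diagram ::
  "'k::field itself \<Rightarrow> nat \<Rightarrow> (nat \<Rightarrow> 'v::linorder set set) \<Rightarrow> nat \<Rightarrow> (ereal \<times> ereal) multiset"
  where
  "persistence_diagram k n F m =
     (\<Sum>i\<in>{0..m}. \<Sum>j\<in>{i<..m}.
        replicate_mset (finite_multiplicity k n F i j) (ereal (real i), ereal (real j)))
   + (\<Sum>i\<in>{0..m}. replicate_mset (infinite_multiplicity k n F m i) (ereal (real i), \<infinity>))"

definition clique_diagram ::
  "'k::field itself \<Rightarrow> nat \<Rightarrow> 'v::linorder pair_pre_digraph \<Rightarrow> (ereal \<times> ereal) multiset" where
  "clique_diagram k n G =
     persistence_diagram k n (\<lambda>i. skeleton i (clique_complex G)) (complex_dim (clique_complex G))"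


section \<open>Bottleneck distance\<close>

text \<open>\<^typ>\<open>ereal\<close> has \<open>\<infinity> - \<infinity> = \<infinity>\<close>, whereas the convention needed here is \<open>\<bar>\<infinity> - \<infinity>\<bar> = 0\<close>.\<close>

definition coord_dist :: "ereal \<Rightarrow> ereal \<Rightarrow> ereal" where
  "coord_dist a b = (if a = b then 0 else \<bar>a - b\<bar>)"

definition point_dist :: "ereal \<times> ereal \<Rightarrow> ereal \<times> ereal \<Rightarrow> ereal" where
  "point_dist x y = max (coord_dist (fst x) (fst y)) (coord_dist (snd x) (snd y))"

text \<open>A multiset is turned into a set by numbering the copies of each element. All diagonal
  points are added, each with infinitely many copies.\<close>

definition with_diagonal :: "(ereal \<times> ereal) multiset \<Rightarrow> ((ereal \<times> ereal) \<times> nat) set" where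
  "with_diagonal X = {(x, n). n < count X x \<or> (\<exists>a::real. x = (ereal a, ereal a))}"

definition bottleneck_distance ::
  "(ereal \<times> ereal) multiset \<Rightarrow> (ereal \<times> ereal) multiset \<Rightarrow> ereal" where
  "bottleneck_distance X Y =
     (INF \<eta>\<in>{\<eta>. bij_betw \<eta> (with_diagonal X) (with_diagonal Y)}.
        SUP x\<in>with_diagonal X. point_dist (fst x) (fst (\<eta> x)))"

end

theory Submission
  imports Defs
begin

text \<open>
  A point \<open>(i, \<infinity>)\<close> of a persistence diagram lies at infinite distance from every point whose second
  coordinate is finite, and hence from the diagonal. So two diagrams with different numbers of such
  essential points have bottleneck distance \<open>\<infinity>\<close>, whatever matching is used
  (\<open>card_essential_points_le\<close>), whereas \<open>\<alpha>\<close> times the graph distance is a real number.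

  In the filtration by skeleta of a finite complex \<open>K\<close>, a class of \<open>H\<^sub>p\<close> that never dies can only be born
  at index \<open>p\<close>: there are no \<open>p\<close>-chains before that index, and all \<open>p\<close>-cycles of \<open>K\<close> are present from
  it on. The essential points are therefore copies of \<open>(p, \<infinity>)\<close>, and their number is the Betti number
  \<open>\<beta>\<^sub>p(K)\<close> (\<open>count_essential\<close>). It remains to find two graphs on the same vertices whose clique complexes
  have different \<open>\<beta>\<^sub>p\<close> (\<open>bottleneck_distance_infinite\<close>).

  The first graph is the cocktail party graph on \<open>p + 1\<close> pairs of vertices, in which two vertices are
  adjacent unless they form a pair. Its clique complex is the boundary of a cross-polytope, a
  \<open>p\<close>-sphere; its signed sum of facets is a cycle, and there are no \<open>(p + 1)\<close>-simplices that could bound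
  it. For \<open>p > 0\<close> the second graph has no edges, so that \<open>\<beta>\<^sub>p = 0\<close>. For \<open>p = 0\<close> no nonempty graph has
  \<open>\<beta>\<^sub>0 = 0\<close>; the cocktail party graph then consists of two isolated points, with \<open>\<beta>\<^sub>0 \<ge> 2\<close>, and the second
  graph is the edge that joins them, with \<open>\<beta>\<^sub>0 \<le> 1\<close>.

  Dimensions are computed through the linear map that sends a cycle of \<open>K\<close> to its class in the
  homology of \<open>L\<close> and is onto the persistent homology (\<open>linear_map_homology_class\<close>). Two cycles have
  the same class exactly if their difference is a boundary (\<open>homology_class_eq_iff\<close>).
\<close>

section \<open>Linear algebra\<close>

text \<open>The vector space laws of \<open>W\<close> are inherited from \<open>V\<close> through \<open>f\<close>. This gives the vector space
  structure of a quotient, and linearity of the projection, from a description of the operations on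
  representatives.\<close>

lemma linear_map_onto_image:
  assumes "vectorspace K V"
    and carrier: "carrier W = f ` carrier V"
    and zero: "\<zero>\<^bsub>W\<^esub> = f \<zero>\<^bsub>V\<^esub>"
    and add: "\<And>x y. x \<in> carrier V \<Longrightarrow> y \<in> carrier V \<Longrightarrow> f x \<oplus>\<^bsub>W\<^esub> f y = f (x \<oplus>\<^bsub>V\<^esub> y)"
    and smult: "\<And>a x. a \<in> carrier K \<Longrightarrow> x \<in> carrier V \<Longrightarrow> a \<odot>\<^bsub>W\<^esub> f x = f (a \<odot>\<^bsub>V\<^esub> x)"
  shows "linear_map K V W f"
proof -
  interpret V: vectorspace K V by fact
  have "field K" ..
  moreover have "\<exists>y\<in>carrier V. f x \<oplus>\<^bsub>W\<^esub> f y = f \<zero>\<^bsub>V\<^esub>" if "x \<in> carrier V" for x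
    using that by (intro bexI[of _ "\<ominus>\<^bsub>V\<^esub> x"]) (simp_all add: add V.r_neg)
  ultimately have W: "vectorspace K W"
    by (intro vs_criteria)
      (auto simp: carrier zero add smult V.a_ac V.smult_l_distr V.smult_r_distr V.smult_assoc1)
  then interpret W: vectorspace K W .
  have "mod_hom K V W f"
    by unfold_locales (auto simp: module_hom_def carrier add smult)
  then show ?thesis
    using assms(1) W by (simp add: linear_map_def)
qed

text \<open>An independent subset of \<open>W\<close> is independent in \<open>V\<close>, so its size is bounded by the dimension
  of \<open>V\<close>; a largest one is a finite basis of \<open>W\<close>.\<close>

lemma (in vectorspace) fin_dim_subspace:
  assumes fd: fin_dim and W: "VectorSpace.subspace K W V"
  shows "vectorspace.fin_dim K (vs W)"
proof -
  have sub: "submodule K W V" using W by (simp add: VectorSpace.subspace_def)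
  interpret W: vectorspace K "vs W" using W by (rule subspace_is_vs)
  have li: "W.lin_indpt A \<longleftrightarrow> lin_indpt A" if "A \<subseteq> W" for A
    using span_li_not_depend(2)[OF that sub] by simp
  have WV: "W \<subseteq> carrier V" using sub by (rule submodule.subset)
  have "\<exists>A. finite A \<and> maximal A (\<lambda>S. S \<subseteq> carrier (vs W) \<and> W.lin_indpt S)"
  proof (rule maximal_exists)
    show "finite A \<and> card A \<le> dim" if "A \<subseteq> carrier (vs W) \<and> W.lin_indpt A" for A
      using that li[of A] WV li_le_dim[OF fd, of A] by auto
    show "{} \<subseteq> carrier (vs W) \<and> W.lin_indpt {}"
      by (auto simp: W.lin_dep_def)
  qed
  then show ?thesis
    using W.max_li_is_basis unfolding W.fin_dim_def W.basis_def by blast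
qed

section \<open>Chains, cycles and boundaries\<close>

abbreviation scale :: "'k::field \<Rightarrow> ('s \<Rightarrow>\<^sub>0 'k) \<Rightarrow> ('s \<Rightarrow>\<^sub>0 'k)" where
  "scale a \<equiv> Poly_Mapping.map ((*) a)"

lemma lookup_scale [simp]:
  "Poly_Mapping.lookup (scale a c) S = a * Poly_Mapping.lookup c S"
  by (simp add: Poly_Mapping.map.rep_eq when_def)

lemma scale_single: "scale a (Poly_Mapping.single S b) = Poly_Mapping.single S (a * b)"
  by (rule poly_mapping_eqI) (simp add: lookup_single when_def)

lemma scale_add: "scale a (c + d) = scale a c + scale a d"
  by (rule poly_mapping_eqI) (simp add: lookup_add distrib_left)

lemma scale_add_left: "scale (a + b) c = scale a c + scale b c"
  by (rule poly_mapping_eqI) (simp add: lookup_add distrib_right)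

lemma scale_scale: "scale a (scale b c) = scale (a * b) c"
  by (rule poly_mapping_eqI) (simp add: mult.assoc)

lemma scale_one: "scale 1 c = c"
  by (rule poly_mapping_eqI) simp

lemma scale_zero: "scale a 0 = 0"
  by (rule poly_mapping_eqI) simp

lemma scale_minus_one: "scale (- 1) c = - c"
  by (rule poly_mapping_eqI) simp

lemma keys_scale: "Poly_Mapping.keys (scale a c) \<subseteq> Poly_Mapping.keys c"
  by (auto simp: in_keys_iff)

lemma chain_space_simps [simp]:
  "add (chain_space n K) = (+)" "zero (chain_space n K) = 0"
  "module.smult (chain_space n K) = scale"
  by (simp_all add: chain_space_def)

lemma carrier_chain_space:
  "carrier (chain_space n K) = {c. Poly_Mapping.keys c \<subseteq> {S \<in> K. card S = n + 1}}"
  by (simp add: chain_space_def)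

lemma carrier_chain_space_trivial:
  assumes "\<And>S. S \<in> K \<Longrightarrow> card S \<noteq> n + 1"
  shows "carrier (chain_space n K) = {0}"
proof -
  have no_simplices: "{S \<in> K. card S = n + 1} = {}" using assms by blast
  show ?thesis unfolding carrier_chain_space no_simplices by simp
qed

lemma vectorspace_chain_space:
  fixes K :: "'v set set"
  shows "vectorspace (class_ring :: 'k::field ring) (chain_space n K)"
proof (intro vs_criteria ballI allI impI class_field)
  fix v w :: "'v set \<Rightarrow>\<^sub>0 'k"
  assume "v \<in> carrier (chain_space n K) \<and> w \<in> carrier (chain_space n K)"
  then show "v \<oplus>\<^bsub>chain_space n K\<^esub> w \<in> carrier (chain_space n K)"
    using keys_add[of v w] by (auto simp: carrier_chain_space)
next
  fix v :: "'v set \<Rightarrow>\<^sub>0 'k"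
  assume "v \<in> carrier (chain_space n K)"
  then show "\<exists>w\<in>carrier (chain_space n K). v \<oplus>\<^bsub>chain_space n K\<^esub> w = \<zero>\<^bsub>chain_space n K\<^esub>"
    by (intro bexI[of _ "- v"]) (auto simp: carrier_chain_space keys_minus)
next
  fix c :: 'k and v :: "'v set \<Rightarrow>\<^sub>0 'k"
  assume "c \<in> carrier class_ring \<and> v \<in> carrier (chain_space n K)"
  then show "c \<odot>\<^bsub>chain_space n K\<^esub> v \<in> carrier (chain_space n K)"
    using keys_scale[of c v] by (auto simp: carrier_chain_space)
qed (simp_all add: carrier_chain_space scale_add scale_add_left scale_scale scale_one
    add.assoc add.commute)

lemma fin_dim_chain_space:
  assumes "finite K"
  shows "vectorspace.fin_dim (class_ring :: 'k::field ring)
           (chain_space n K :: ('k, 'v set \<Rightarrow>\<^sub>0 'k) module)"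
proof -
  let ?C = "chain_space n K :: ('k, 'v set \<Rightarrow>\<^sub>0 'k) module"
  let ?K = "{S \<in> K. card S = n + 1}"
  let ?B = "(\<lambda>S. Poly_Mapping.single S (1::'k)) ` ?K"
  interpret C: vectorspace "class_ring :: 'k ring" ?C by (rule vectorspace_chain_space)
  have B: "finite ?B" "?B \<subseteq> carrier ?C"
    using assms by (auto simp: carrier_chain_space)
  interpret S: submodule "class_ring :: 'k ring" "C.span ?B" ?C
    using B(2) by (rule C.span_is_submodule)
  have "c \<in> C.span ?B" if c: "c \<in> carrier ?C" for c
  proof -
    have *: "(\<Sum>S\<in>A. Poly_Mapping.single S (Poly_Mapping.lookup c S)) \<in> C.span ?B"
      if "finite A" "A \<subseteq> ?K" for A
      using that
    proof (induction A rule: finite_induct)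
      case empty
      show ?case using S.zero_closed by simp
    next
      case (insert S A)
      have "Poly_Mapping.single S (1::'k) \<in> C.span ?B"
        using insert.prems C.in_own_span[OF B(2)] by blast
      then have "Poly_Mapping.single S (Poly_Mapping.lookup c S) \<in> C.span ?B"
        using S.smult_closed[of "Poly_Mapping.lookup c S" "Poly_Mapping.single S 1"]
        by (simp add: scale_single)
      then show ?case
        using S.m_closed insert by simp
    qed
    have "Poly_Mapping.keys c \<subseteq> ?K" using c by (simp add: carrier_chain_space)
    from *[OF finite_keys this]
    have "(\<Sum>S\<in>Poly_Mapping.keys c. Poly_Mapping.single S (Poly_Mapping.lookup c S))
        \<in> C.span ?B" .
    also have "(\<Sum>S\<in>Poly_Mapping.keys c. Poly_Mapping.single S (Poly_Mapping.lookup c S)) = c"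
      by (rule poly_mapping_eqI) (simp add: lookup_sum lookup_single when_def in_keys_iff)
    finally show ?thesis .
  qed
  then have "C.gen_set ?B" using C.span_is_subset2[OF B(2)] by blast
  then show ?thesis using B unfolding C.fin_dim_def by blast
qed

text \<open>The support varies with the chain. Summing over a fixed larger set instead makes linearity of the
  boundary visible.\<close>

lemma boundary_eq_sum:
  assumes "n \<noteq> 0" "finite A" "Poly_Mapping.keys c \<subseteq> A"
  shows "boundary n c = (\<Sum>S\<in>A. \<Sum>v\<in>S. Poly_Mapping.single (S - {v})
           ((- 1) ^ card {u \<in> S. u < v} * Poly_Mapping.lookup c S))"
  unfolding boundary_def using assms
  by (simp add: in_keys_iff) (rule sum.mono_neutral_left; auto simp: in_keys_iff)

lemma boundary_add: "boundary n (c + d) = boundary n c + boundary n d"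
proof (cases "n = 0")
  case False
  let ?A = "Poly_Mapping.keys c \<union> Poly_Mapping.keys d"
  show ?thesis
    using keys_add[of c d]
    by (simp add: boundary_eq_sum[OF False, of ?A] lookup_add distrib_left single_add sum.distrib)
qed (simp add: boundary_def)

lemma boundary_scale: "boundary n (scale a c) = scale a (boundary n c)"
proof (cases "n = 0")
  case False
  have scale_sum: "scale a (sum f A) = (\<Sum>x\<in>A. scale a (f x))" for f :: "'x \<Rightarrow> 'a set \<Rightarrow>\<^sub>0 'b" and A
    by (rule poly_mapping_eqI) (simp add: lookup_sum sum_distrib_left)
  show ?thesis
    using keys_scale[of a c]
    by (simp add: boundary_eq_sum[OF False, of "Poly_Mapping.keys c"] scale_sum scale_single
        mult.left_commute)
qed (simp add: boundary_def scale_zero)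

lemma boundary_zero [simp]: "boundary n 0 = 0"
  by (simp add: boundary_def)

lemma cycle_space_simps [simp]:
  "add (cycle_space n K) = (+)" "zero (cycle_space n K) = 0"
  "module.smult (cycle_space n K) = scale"
  by (simp_all add: cycle_space_def)

lemma carrier_cycle_space:
  "carrier (cycle_space n K) = {c \<in> carrier (chain_space n K). boundary n c = 0}"
  by (simp add: cycle_space_def)

lemma subspace_cycles:
  "VectorSpace.subspace (class_ring :: 'k::field ring)
     {c \<in> carrier (chain_space n K). boundary n c = 0} (chain_space n K)"
proof -
  interpret C: vectorspace "class_ring :: 'k ring" "chain_space n K"
    by (rule vectorspace_chain_space)
  have "submodule (class_ring :: 'k ring)
     {c \<in> carrier (chain_space n K). boundary n c = 0} (chain_space n K)"
  proof (rule submodule.intro)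
    show "Module.module (class_ring :: 'k ring) (chain_space n K)" ..
  qed (use C.M.zero_closed C.M.a_closed C.smult_closed in
      \<open>simp_all add: boundary_add boundary_scale scale_zero subset_iff\<close>)
  then show ?thesis
    by (simp add: VectorSpace.subspace_def C.vectorspace_axioms)
qed

lemma vectorspace_cycle_space: "vectorspace (class_ring :: 'k::field ring) (cycle_space n K)"
  unfolding cycle_space_def
  by (rule vectorspace.subspace_is_vs[OF vectorspace_chain_space subspace_cycles])

lemma fin_dim_cycle_space:
  "finite K \<Longrightarrow> vectorspace.fin_dim (class_ring :: 'k::field ring) (cycle_space n K)"
  unfolding cycle_space_def
  by (intro vectorspace.fin_dim_subspace[OF vectorspace_chain_space] fin_dim_chain_space
      subspace_cycles)

lemma carrier_chain_space_mono:
  "K \<subseteq> L \<Longrightarrow> carrier (chain_space n K) \<subseteq> carrier (chain_space n L)"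
  by (auto simp: carrier_chain_space)

lemma zero_in_boundaries: "0 \<in> boundaries n K"
  by (auto simp: boundaries_def carrier_chain_space intro!: image_eqI[of _ _ 0])

lemma boundaries_add:
  assumes "b \<in> boundaries n K" "b' \<in> boundaries n K"
  shows "b + b' \<in> boundaries n K"
proof -
  obtain c c' where "b = boundary (n + 1) c" "c \<in> carrier (chain_space (n + 1) K)"
    "b' = boundary (n + 1) c'" "c' \<in> carrier (chain_space (n + 1) K)"
    using assms by (auto simp: boundaries_def)
  then show ?thesis
    using keys_add[of c c'] unfolding boundaries_def
    by (intro image_eqI[of _ _ "c + c'"]) (auto simp: boundary_add carrier_chain_space)
qed

lemma boundaries_scale:
  assumes "b \<in> boundaries n K"
  shows "scale a b \<in> boundaries n K"
proof -
  obtain c where "b = boundary (n + 1) c" "c \<in> carrier (chain_space (n + 1) K)"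
    using assms by (auto simp: boundaries_def)
  then show ?thesis
    using keys_scale[of a c] unfolding boundaries_def
    by (intro image_eqI[of _ _ "scale a c"]) (auto simp: boundary_scale carrier_chain_space)
qed

lemma boundaries_diff:
  assumes "b \<in> boundaries n K" "b' \<in> boundaries n K"
  shows "b - b' \<in> boundaries n K"
proof -
  have "b + scale (- 1) b' \<in> boundaries n K"
    by (intro boundaries_add boundaries_scale assms)
  then show ?thesis unfolding scale_minus_one by simp
qed

section \<open>Persistent homology as a quotient of cycles\<close>

text \<open>These are the cosets of the boundaries of \<open>L\<close>. They are defined for all chains, so that one map
  serves every subcomplex \<open>K\<close> whose cycles are sent to the homology of \<open>L\<close>.\<close>

definition homology_class ::
  "nat \<Rightarrow> 'v::linorder set set \<Rightarrow> ('v set \<Rightarrow>\<^sub>0 'k::field) \<Rightarrow> ('v set \<Rightarrow>\<^sub>0 'k) set" where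
  "homology_class n L z = {x. x - z \<in> boundaries n L}"

lemma self_in_homology_class: "z \<in> homology_class n L z"
  by (simp add: homology_class_def zero_in_boundaries)

lemma r_coset_eq_homology_class: "boundaries n L +>\<^bsub>cycle_space n K\<^esub> z = homology_class n L z"
proof (intro equalityI subsetI)
  fix x
  assume "x \<in> homology_class n L z"
  then show "x \<in> boundaries n L +>\<^bsub>cycle_space n K\<^esub> z"
    by (auto simp: a_r_coset_def' homology_class_def intro!: bexI[of _ "x - z"])
qed (auto simp: a_r_coset_def' homology_class_def)

lemma homology_class_eq_iff:
  "homology_class n L y = homology_class n L z \<longleftrightarrow> y - z \<in> boundaries n L"
proof
  assume "homology_class n L y = homology_class n L z"
  then show "y - z \<in> boundaries n L"
    using self_in_homology_class[of y n L] by (simp add: homology_class_def)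
next
  assume yz: "y - z \<in> boundaries n L"
  have "x - y \<in> boundaries n L \<longleftrightarrow> x - z \<in> boundaries n L" for x
    using boundaries_add[OF _ yz, of "x - y"] boundaries_diff[OF _ yz, of "x - z"] by auto
  then show "homology_class n L y = homology_class n L z"
    by (simp add: homology_class_def)
qed

text \<open>The inclusion \<open>K \<subseteq> L\<close> sends the class of a cycle \<open>z\<close> in \<open>K\<close> to its class in \<open>L\<close>, because boundaries
  in \<open>K\<close> are boundaries in \<open>L\<close>. So the image of the homology of \<open>K\<close> consists of the classes in \<open>L\<close> of the
  cycles of \<open>K\<close>, and can be studied without the homology of \<open>K\<close>.\<close>

lemma linear_map_homology_class:
  fixes K L :: "'v::linorder set set"
  assumes "K \<subseteq> L"
  shows "linear_map (class_ring :: 'k::field ring) (cycle_space n K) (persistent_homology n K L)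
           (homology_class n L)"
    and "carrier (persistent_homology n K L :: ('k, ('v set \<Rightarrow>\<^sub>0 'k) set) module)
           = homology_class n L ` carrier (cycle_space n K)"
proof -
  let ?H = "persistent_homology n K L :: ('k, ('v set \<Rightarrow>\<^sub>0 'k) set) module"
  have BKL: "boundaries n K \<subseteq> (boundaries n L :: ('v set \<Rightarrow>\<^sub>0 'k) set)"
    unfolding boundaries_def by (intro image_mono carrier_chain_space_mono assms)
  have class_union: "(\<Union>x\<in>homology_class n M z. homology_class n L x) = homology_class n L z"
    if sub: "boundaries n M \<subseteq> (boundaries n L :: ('v set \<Rightarrow>\<^sub>0 'k) set)" for M and z :: "'v set \<Rightarrow>\<^sub>0 'k"
  proof -
    have "homology_class n L x = homology_class n L z" if "x \<in> homology_class n M z" for x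
      using that subsetD[OF sub, of "x - z"]
      by (simp add: homology_class_eq_iff homology_class_def[of n M])
    then show ?thesis using self_in_homology_class[of z n M] by blast
  qed
  have carrier_H: "carrier (homology n K :: ('k, ('v set \<Rightarrow>\<^sub>0 'k) set) module)
      = homology_class n K ` carrier (cycle_space n K)"
    by (simp add: homology_def quotient_module_def A_RCOSETS_def' r_coset_eq_homology_class
        UNION_singleton_eq_range)
  show carrier: "carrier ?H = homology_class n L ` carrier (cycle_space n K)"
    by (simp add: persistent_homology_def carrier_H image_image homology_inclusion_def
        r_coset_eq_homology_class class_union[OF BKL])
  have zero: "\<zero>\<^bsub>?H\<^esub> = homology_class n L 0"
    by (simp add: persistent_homology_def homology_def quotient_module_def homology_class_def)
  have add: "homology_class n L y \<oplus>\<^bsub>?H\<^esub> homology_class n L z = homology_class n L (y + z)" for y z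
  proof -
    have "homology_class n L y \<oplus>\<^bsub>?H\<^esub> homology_class n L z
        = (\<Union>x\<in>homology_class n L y. \<Union>x'\<in>homology_class n L z. {x + x'})"
      by (simp add: persistent_homology_def homology_def quotient_module_def set_add_def
          set_mult_def)
    also have "\<dots> = homology_class n L (y + z)"
    proof (intro equalityI subsetI)
      fix x assume "x \<in> (\<Union>x\<in>homology_class n L y. \<Union>x'\<in>homology_class n L z. {x + x'})"
      then obtain u v where "u - y \<in> boundaries n L" "v - z \<in> boundaries n L" "x = u + v"
        by (auto simp: homology_class_def)
      moreover have "u + v - (y + z) = (u - y) + (v - z)" by simp
      ultimately show "x \<in> homology_class n L (y + z)"
        unfolding homology_class_def mem_Collect_eq by (simp only: boundaries_add)
    next
      fix x assume "x \<in> homology_class n L (y + z)"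
      then have "x - z \<in> homology_class n L y"
        by (simp add: homology_class_def diff_diff_eq add.commute)
      then show "x \<in> (\<Union>x\<in>homology_class n L y. \<Union>x'\<in>homology_class n L z. {x + x'})"
        using self_in_homology_class[of z n L] by force
    qed
    finally show ?thesis .
  qed
  have smult: "a \<odot>\<^bsub>?H\<^esub> homology_class n L z = homology_class n L (scale a z)" for a z
  proof -
    have "homology_class n L (scale a x) = homology_class n L (scale a z)"
      if "x \<in> homology_class n L z" for x
    proof -
      have "scale a x - scale a z = scale a (x - z)"
        by (rule poly_mapping_eqI) (simp add: lookup_minus right_diff_distrib)
      moreover have "x - z \<in> boundaries n L" using that by (simp add: homology_class_def)
      ultimately show ?thesis by (simp add: homology_class_eq_iff boundaries_scale)
    qed
    then have "(\<Union>x\<in>homology_class n L z. homology_class n L (scale a x))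
        = homology_class n L (scale a z)"
      using self_in_homology_class[of z n L] by blast
    then show ?thesis
      by (simp add: persistent_homology_def homology_def quotient_module_def
          r_coset_eq_homology_class)
  qed
  show "linear_map class_ring (cycle_space n K) ?H (homology_class n L)"
    by (rule linear_map_onto_image[OF vectorspace_cycle_space carrier])
      (simp_all add: zero add smult)
qed

section \<open>Persistent Betti numbers\<close>

lemma vectorspace_persistent_homology:
  "K \<subseteq> L \<Longrightarrow> vectorspace (class_ring :: 'k::field ring) (persistent_homology n K L)"
  using linear_map_homology_class(1) by (rule linear_map.axioms(2))

text \<open>The class of \<open>z\<close> spans the persistent homology.\<close>

lemma persistent_betti_le_1:
  fixes z :: "'v::linorder set \<Rightarrow>\<^sub>0 'k::field"
  assumes "K \<subseteq> L" and z: "z \<in> carrier (cycle_space n K)"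
    and hom: "\<And>c. c \<in> carrier (cycle_space n K) \<Longrightarrow> \<exists>a. c - scale a z \<in> boundaries n L"
  shows "persistent_betti TYPE('k) n K L \<le> 1"
proof -
  let ?H = "persistent_homology n K L :: ('k, ('v set \<Rightarrow>\<^sub>0 'k) set) module"
  interpret H: vectorspace "class_ring :: 'k ring" ?H
    using assms(1) by (rule vectorspace_persistent_homology)
  interpret T: linear_map "class_ring :: 'k ring" "cycle_space n K" ?H "homology_class n L"
    using assms(1) by (rule linear_map_homology_class)
  note carrier = linear_map_homology_class(2)[OF assms(1), where n = n and 'k = 'k]
  let ?z = "homology_class n L z"
  have z': "?z \<in> carrier ?H" using z unfolding carrier by blast
  interpret S: submodule "class_ring :: 'k ring" "H.span {?z}" ?H
    using z' by (intro H.span_is_submodule) simp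
  have "x \<in> H.span {?z}" if x: "x \<in> carrier ?H" for x
  proof -
    obtain c where c: "c \<in> carrier (cycle_space n K)" "x = homology_class n L c"
      using x unfolding carrier by blast
    obtain a where "c - scale a z \<in> boundaries n L" using hom c(1) by blast
    then have "x = homology_class n L (scale a z)" by (simp add: c(2) homology_class_eq_iff)
    also have "\<dots> = a \<odot>\<^bsub>?H\<^esub> ?z" using T.T_smult[of a z] z by simp
    also have "\<dots> \<in> H.span {?z}"
      using H.in_own_span[of "{?z}"] z' by (intro S.smult_closed) auto
    finally show ?thesis .
  qed
  then have "H.gen_set {?z}" using H.span_is_subset2[of "{?z}"] z' by blast
  then have "H.dim \<le> 1" using z' by (rule H.dim_le1I)
  then show ?thesis by (simp add: persistent_betti_def)
qed

lemma persistent_betti_eq_0: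
  fixes K L :: "'v::linorder set set"
  assumes "K \<subseteq> L" and no_simplices: "\<And>S. S \<in> K \<Longrightarrow> card S \<noteq> n + 1"
  shows "persistent_betti TYPE('k::field) n K L = 0"
proof -
  let ?H = "persistent_homology n K L :: ('k, ('v set \<Rightarrow>\<^sub>0 'k) set) module"
  interpret H: vectorspace "class_ring :: 'k ring" ?H
    using assms(1) by (rule vectorspace_persistent_homology)
  interpret T: linear_map "class_ring :: 'k ring" "cycle_space n K" ?H "homology_class n L"
    using assms(1) by (rule linear_map_homology_class)
  have "carrier (chain_space n K :: ('k, _) module) = {0}"
    using no_simplices by (rule carrier_chain_space_trivial)
  then have "c \<in> carrier (cycle_space n K :: ('k, _) module) \<longleftrightarrow> c = 0" for c
    by (cases "c = 0") (simp_all add: carrier_cycle_space)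
  then have "carrier (cycle_space n K :: ('k, _) module) = {0}" by blast
  then have "carrier ?H = {homology_class n L 0}"
    unfolding linear_map_homology_class(2)[OF assms(1), where n = n and 'k = 'k] by (rule ssubst) simp
  also have "homology_class n L 0 = \<zero>\<^bsub>?H\<^esub>"
    using T.T0_is_0 unfolding cycle_space_simps .
  finally have carrier: "carrier ?H = {\<zero>\<^bsub>?H\<^esub>}" .
  have sub: "{\<zero>\<^bsub>?H\<^esub>} \<subseteq> carrier ?H" unfolding carrier by (rule subset_refl)
  have "H.gen_set {\<zero>\<^bsub>?H\<^esub>}"
  proof
    show "H.span {\<zero>\<^bsub>?H\<^esub>} \<subseteq> carrier ?H" using sub by (rule H.span_is_subset2)
    show "carrier ?H \<subseteq> H.span {\<zero>\<^bsub>?H\<^esub>}" unfolding carrier using sub by (rule H.in_own_span)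
  qed
  then have "H.dim = 0" by (rule H.dim0I)
  then show ?thesis by (simp add: persistent_betti_def)
qed

text \<open>Without simplices of the next dimension nothing bounds, so that distinct cycles have distinct
  classes.\<close>

lemma persistent_betti_top:
  fixes K L :: "'v::linorder set set"
  assumes "K \<subseteq> L" "finite K" and no_simplices: "\<And>S. S \<in> L \<Longrightarrow> card S \<noteq> n + 2"
  shows "persistent_betti TYPE('k::field) n K L
    = vectorspace.dim (class_ring :: 'k ring) (cycle_space n K)"
proof -
  let ?H = "persistent_homology n K L :: ('k, ('v set \<Rightarrow>\<^sub>0 'k) set) module"
  interpret H: vectorspace "class_ring :: 'k ring" ?H
    using assms(1) by (rule vectorspace_persistent_homology)
  interpret T: linear_map "class_ring :: 'k ring" "cycle_space n K" ?H "homology_class n L"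
    using assms(1) by (rule linear_map_homology_class)
  have "carrier (chain_space (n + 1) L :: ('k, _) module) = {0}"
    using no_simplices by (intro carrier_chain_space_trivial) simp
  then have "boundaries n L = {0 :: 'v set \<Rightarrow>\<^sub>0 'k}"
    by (simp add: boundaries_def)
  then have "inj_on (homology_class n L) (carrier (cycle_space n K :: ('k, _) module))"
    by (simp add: inj_on_def homology_class_eq_iff)
  moreover have "T.V.fin_dim" using assms(2) by (rule fin_dim_cycle_space)
  ultimately have "T.V.dim = H.dim"
    using linear_map_homology_class(2)[OF assms(1), where n = n and 'k = 'k]
    by (intro T.dim_eq) simp_all
  then show ?thesis by (simp add: persistent_betti_def)
qed

text \<open>The cycles of dimension \<open>n\<close> depend only on the simplices of dimension \<open>n\<close>.\<close>

lemma persistent_betti_cong: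
  fixes K K' L :: "'v::linorder set set"
  assumes "K \<subseteq> L" "K' \<subseteq> L"
    and same: "{S \<in> K. card S = n + 1} = {S \<in> K'. card S = n + 1}"
  shows "persistent_betti TYPE('k::field) n K L = persistent_betti TYPE('k) n K' L"
proof -
  have "cycle_space n K = (cycle_space n K' :: ('k, 'v set \<Rightarrow>\<^sub>0 'k) module)"
    unfolding cycle_space_def chain_space_def same ..
  then have "carrier (persistent_homology n K L :: ('k, ('v set \<Rightarrow>\<^sub>0 'k) set) module)
      = carrier (persistent_homology n K' L)"
    by (simp add: linear_map_homology_class(2) assms(1,2))
  then have "persistent_homology n K L
      = (persistent_homology n K' L :: ('k, ('v set \<Rightarrow>\<^sub>0 'k) set) module)"
    by (simp add: persistent_homology_def)
  then show ?thesis by (simp add: persistent_betti_def)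
qed

section \<open>Essential points of the skeleton filtration\<close>

lemma skeleton_subset: "skeleton i K \<subseteq> K"
  by (auto simp: skeleton_def)

lemma card_le_complex_dim:
  assumes "finite K" "S \<in> K"
  shows "card S \<le> complex_dim K + 1"
proof -
  have "card S - 1 \<le> complex_dim K"
    unfolding complex_dim_def using assms by (intro Max_ge) auto
  then show ?thesis by simp
qed

lemma skeleton_complex_dim: "finite K \<Longrightarrow> skeleton (complex_dim K) K = K"
  using card_le_complex_dim by (auto simp: skeleton_def)

text \<open>The numbers \<open>?b (skeleton j K)\<close> jump once, from \<open>0\<close> to the Betti number of \<open>K\<close>, when the
  \<open>n\<close>-simplices enter at \<open>j = n\<close>. The multiplicity at \<open>i\<close> is the jump at \<open>i\<close>.\<close>

lemma infinite_multiplicity_skeleta: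
  fixes K :: "'v::linorder set set"
  assumes "finite K"
  shows "infinite_multiplicity TYPE('k::field) n (\<lambda>i. skeleton i K) (complex_dim K) i
    = (if i = n then persistent_betti TYPE('k) n K K else 0)"
proof -
  let ?F = "\<lambda>i. skeleton i K"
  let ?b = "\<lambda>M. persistent_betti TYPE('k) n M K"
  have early: "?b (skeleton j K) = 0" if "j < n" for j
    using that by (intro persistent_betti_eq_0 skeleton_subset) (auto simp: skeleton_def)
  have late: "?b (skeleton j K) = ?b K" if "n \<le> j" for j
    using that by (intro persistent_betti_cong skeleton_subset subset_refl) (auto simp: skeleton_def)
  have "?b {} = 0" by (intro persistent_betti_eq_0) auto
  then have before: "?b (filtration_before ?F i) = (if n < i then ?b K else 0)"
    using early[of "i - 1"] late[of "i - 1"] by (auto simp: filtration_before_def)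
  show ?thesis
    using early[of i] late[of i]
    by (auto simp: infinite_multiplicity_def before skeleton_complex_dim[OF assms])
qed

text \<open>The diagram only has points with births up to the dimension of \<open>K\<close>. If \<open>n\<close> exceeds it then the
  birth \<open>n\<close> does not occur, but the Betti number vanishes as well.\<close>

lemma count_essential:
  fixes K :: "'v::linorder set set"
  assumes "finite K"
  shows "count (persistence_diagram TYPE('k::field) n (\<lambda>i. skeleton i K) (complex_dim K)) (x, \<infinity>)
    = (if x = ereal (real n) then persistent_betti TYPE('k) n K K else 0)"
proof -
  let ?b = "persistent_betti TYPE('k) n K K"
  have vanish: "?b = 0" if "complex_dim K < n"
  proof (rule persistent_betti_eq_0)
    show "card S \<noteq> n + 1" if "S \<in> K" for S
      using card_le_complex_dim[OF assms that] \<open>complex_dim K < n\<close> by simp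
  qed simp
  have "count (persistence_diagram TYPE('k) n (\<lambda>i. skeleton i K) (complex_dim K)) (x, \<infinity>)
      = (\<Sum>i\<in>{0..complex_dim K}. if i = n then (if x = ereal (real n) then ?b else 0) else 0)"
    unfolding persistence_diagram_def infinite_multiplicity_skeleta[OF assms]
    by (auto simp: count_sum intro!: sum.cong)
  also have "\<dots> = (if x = ereal (real n) then ?b else 0)"
    using vanish by (subst sum.delta) auto
  finally show ?thesis .
qed

section \<open>Bottleneck distance\<close>

definition essential_points :: "(ereal \<times> ereal) multiset \<Rightarrow> ((ereal \<times> ereal) \<times> nat) set" where
  "essential_points X = {(x, n). n < count X x \<and> snd x = \<infinity>}"

lemma finite_essential_points: "finite (essential_points X)"
proof (rule finite_subset)
  show "essential_points X \<subseteq> set_mset X \<times> {..<size X}"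
  proof
    fix x assume "x \<in> essential_points X"
    then obtain y n where "x = (y, n)" "n < count X y" by (auto simp: essential_points_def)
    moreover from this have "y \<in># X" by (simp flip: count_greater_zero_iff)
    ultimately show "x \<in> set_mset X \<times> {..<size X}"
      using count_le_size[of X y] by simp
  qed
qed simp

text \<open>A matching of finite cost sends essential points to essential points, as a finite second
  coordinate is infinitely far from \<open>\<infinity>\<close>. It is injective on them.\<close>

lemma card_essential_points_le:
  assumes "bottleneck_distance X Y < \<infinity>"
  shows "card (essential_points X) \<le> card (essential_points Y)"
proof -
  obtain \<eta> where bij: "bij_betw \<eta> (with_diagonal X) (with_diagonal Y)"
    and fin: "(SUP x\<in>with_diagonal X. point_dist (fst x) (fst (\<eta> x))) < \<infinity>"
    using assms unfolding bottleneck_distance_def INF_less_iff by blast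
  have sub: "essential_points X \<subseteq> with_diagonal X"
    by (auto simp: essential_points_def with_diagonal_def)
  have "\<eta> x \<in> essential_points Y" if x: "x \<in> essential_points X" for x
  proof -
    have mem: "x \<in> with_diagonal X" using x sub by blast
    then have "point_dist (fst x) (fst (\<eta> x)) < \<infinity>"
      using fin by (meson SUP_upper le_less_trans)
    moreover have "snd (fst x) = \<infinity>" using x by (auto simp: essential_points_def)
    ultimately have "snd (fst (\<eta> x)) = \<infinity>"
      by (cases "snd (fst (\<eta> x))") (auto simp: point_dist_def coord_dist_def split: if_splits)
    moreover obtain y m where y: "\<eta> x = (y, m)" by fastforce
    ultimately have "\<not> (\<exists>a::real. y = (ereal a, ereal a))" by auto
    moreover have "(y, m) \<in> with_diagonal Y" using bij_betwE[OF bij] mem y by metis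
    ultimately show ?thesis
      using \<open>snd (fst (\<eta> x)) = \<infinity>\<close> by (simp add: y essential_points_def with_diagonal_def)
  qed
  moreover have "inj_on \<eta> (essential_points X)"
    using bij sub by (auto simp: bij_betw_def intro: inj_on_subset)
  ultimately show ?thesis
    by (intro card_inj_on_le[of \<eta>] finite_essential_points) auto
qed

lemma card_essential_points_skeleta:
  fixes K :: "'v::linorder set set"
  assumes "finite K"
  shows "card (essential_points
      (persistence_diagram TYPE('k::field) n (\<lambda>i. skeleton i K) (complex_dim K)))
    = persistent_betti TYPE('k) n K K"
proof -
  have "essential_points (persistence_diagram TYPE('k) n (\<lambda>i. skeleton i K) (complex_dim K))
      = {(ereal (real n), \<infinity>)} \<times> {..<persistent_betti TYPE('k) n K K}"
    by (auto simp: essential_points_def count_essential[OF assms] split: if_splits)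
  then show ?thesis by (simp add: card_cartesian_product)
qed

lemma finite_clique_complex:
  assumes "pair_graph G"
  shows "finite (clique_complex G)"
proof -
  interpret pair_graph G by fact
  have "clique_complex G \<subseteq> Pow (pverts G)"
    by (auto simp: clique_complex_def clique_def)
  then show ?thesis by (rule finite_subset) (simp add: pair_finite_verts)
qed

lemma bottleneck_distance_infinite:
  fixes G H :: "'v::linorder pair_pre_digraph"
  assumes "pair_graph G" "pair_graph H"
    and less: "persistent_betti TYPE('k::field) p (clique_complex H) (clique_complex H)
      < persistent_betti TYPE('k) p (clique_complex G) (clique_complex G)"
  shows "bottleneck_distance (clique_diagram TYPE('k) p G) (clique_diagram TYPE('k) p H) = \<infinity>"
proof (rule ccontr)
  assume "bottleneck_distance (clique_diagram TYPE('k) p G) (clique_diagram TYPE('k) p H) \<noteq> \<infinity>"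
  then have "card (essential_points (clique_diagram TYPE('k) p G))
      \<le> card (essential_points (clique_diagram TYPE('k) p H))"
    by (intro card_essential_points_le) simp
  then show False
    using less by (simp add: clique_diagram_def card_essential_points_skeleta finite_clique_complex
        assms(1,2))
qed

text \<open>Independence is stated with sums of chains, which are computed coefficientwise.\<close>

lemma card_independent_cycles_le_betti:
  fixes K L :: "'v::linorder set set" and A :: "('v set \<Rightarrow>\<^sub>0 'k::field) set"
  assumes "K \<subseteq> L" "finite K" "\<And>S. S \<in> L \<Longrightarrow> card S \<noteq> n + 2"
    and A: "finite A" "A \<subseteq> carrier (cycle_space n K)"
    and indep: "\<And>a. (\<Sum>z\<in>A. scale (a z) z) = 0 \<Longrightarrow> \<forall>z\<in>A. a z = 0"
  shows "card A \<le> persistent_betti TYPE('k) n K L"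
proof -
  let ?Z = "cycle_space n K :: ('k, 'v set \<Rightarrow>\<^sub>0 'k) module"
  interpret Z: vectorspace "class_ring :: 'k ring" ?Z by (rule vectorspace_cycle_space)
  have lincomb: "Z.lincomb a B = (\<Sum>z\<in>B. scale (a z) z)" if "finite B" "B \<subseteq> carrier ?Z" for a B
    using that
  proof (induction B rule: finite_induct)
    case (insert z B)
    then have "Z.lincomb a (insert z B) = a z \<odot>\<^bsub>?Z\<^esub> z \<oplus>\<^bsub>?Z\<^esub> Z.lincomb a B"
      by (intro Z.lincomb_insert2) auto
    then show ?case using insert by simp
  qed (simp add: Z.lincomb_empty)
  have "Z.lin_indpt A"
    using A indep by (intro Z.finite_lin_indpt2) (simp_all add: lincomb)
  then have "card A \<le> Z.dim"
    using A(2) by (intro Z.li_le_dim(2) fin_dim_cycle_space assms(2))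
  then show ?thesis
    using persistent_betti_top[OF assms(1-3), where 'k = 'k] by simp
qed

section \<open>The cross-polytope\<close>

text \<open>The antipodal pairs are \<open>{2 * i, 2 * i + 1}\<close> for \<open>i \<le> p\<close>. With this numbering the vertex of a facet
  that comes from pair \<open>i\<close> has position \<open>i\<close> in the facet, whichever of the two it is. Hence passing to
  the antipode of a vertex does not change the sign with which its opposite face enters the
  boundary.\<close>

definition cocktail_party_graph :: "nat \<Rightarrow> nat pair_pre_digraph" where
  "cocktail_party_graph p =
     \<lparr> pverts = {..<2 * p + 2},
       parcs = {(u, v). u < 2 * p + 2 \<and> v < 2 * p + 2 \<and> u div 2 \<noteq> v div 2} \<rparr>"

definition antipode :: "nat \<Rightarrow> nat" where
  "antipode v = (if even v then v + 1 else v - 1)"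

definition facets :: "nat \<Rightarrow> nat set set" where
  "facets p = {S. S \<subseteq> {..<2 * p + 2} \<and> inj_on (\<lambda>v. v div 2) S \<and> card S = p + 1}"

lemma pair_graph_cocktail_party: "pair_graph (cocktail_party_graph p)"
proof
  have "parcs (cocktail_party_graph p) \<subseteq> {..<2 * p + 2} \<times> {..<2 * p + 2}"
    by (auto simp: cocktail_party_graph_def)
  then show "finite (parcs (cocktail_party_graph p))" by (rule finite_subset) simp
qed (auto simp: cocktail_party_graph_def symmetric_def intro!: symI)

lemma clique_complex_cocktail_party:
  "clique_complex (cocktail_party_graph p)
     = {S. S \<noteq> {} \<and> S \<subseteq> {..<2 * p + 2} \<and> inj_on (\<lambda>v. v div 2) S}"
  by (auto simp: clique_complex_def clique_def cocktail_party_graph_def inj_on_def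
      intro: finite_subset[OF _ finite_lessThan])

text \<open>A simplex contains at most one vertex of each pair, so the cross-polytope has no simplices of
  dimension above \<open>p\<close>.\<close>

lemma card_simplex_cocktail_party:
  assumes "S \<in> clique_complex (cocktail_party_graph p)"
  shows "card S \<le> p + 1"
proof -
  have "card S = card ((\<lambda>v. v div 2) ` S)"
    using assms by (simp add: clique_complex_cocktail_party card_image)
  also have "\<dots> \<le> card {..p}"
    using assms by (intro card_mono) (auto simp: clique_complex_cocktail_party)
  finally show ?thesis by simp
qed

lemma antipode_simps [simp]:
  "antipode v div 2 = v div 2" "antipode (antipode v) = v" "even (antipode v) \<longleftrightarrow> odd v"
  "antipode v \<noteq> v"
  by (auto simp: antipode_def elim!: evenE oddE)

lemma antipode_notin:
  assumes "S \<in> facets p" "v \<in> S"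
  shows "antipode v \<notin> S"
proof
  assume "antipode v \<in> S"
  then have "antipode v = v"
    using assms inj_onD[of "\<lambda>v. v div 2" S "antipode v" v] by (simp add: facets_def)
  then show False by simp
qed

lemma finite_facets: "finite (facets p)"
  by (rule finite_subset[of _ "Pow {..<2 * p + 2}"]) (auto simp: facets_def)

lemma finite_facet: "S \<in> facets p \<Longrightarrow> finite S"
  by (auto simp: facets_def intro: finite_subset[OF _ finite_lessThan])

lemma reflect_facet:
  assumes "S \<in> facets p" "v \<in> S"
  shows "insert (antipode v) (S - {v}) \<in> facets p"
proof -
  have "v < 2 * p + 2" using assms by (auto simp: facets_def)
  then have "antipode v < 2 * p + 2" unfolding antipode_def by presburger
  moreover have "card (insert (antipode v) (S - {v})) = card S"
    using antipode_notin[OF assms] assms(2) finite_facet[OF assms(1)] card_Suc_Diff1[of S v]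
    by simp
  ultimately show ?thesis
    using assms by (auto simp: facets_def inj_on_def)
qed

text \<open>The facets are oriented so that two facets that differ in one vertex have opposite signs: the
  sign is the parity of the number of odd vertices.\<close>

definition fundamental_cycle :: "nat \<Rightarrow> (nat set \<Rightarrow>\<^sub>0 'k::field)" where
  "fundamental_cycle p = (\<Sum>S\<in>facets p. Poly_Mapping.single S ((- 1) ^ card {u \<in> S. odd u}))"

lemma lookup_fundamental_cycle:
  "Poly_Mapping.lookup (fundamental_cycle p :: nat set \<Rightarrow>\<^sub>0 'k::field) S
     = (if S \<in> facets p then (- 1) ^ card {u \<in> S. odd u} else 0)"
  by (simp add: fundamental_cycle_def lookup_sum lookup_single when_def finite_facets)

lemma keys_fundamental_cycle:
  "Poly_Mapping.keys (fundamental_cycle p :: nat set \<Rightarrow>\<^sub>0 'k::field) \<subseteq> facets p"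
  by (auto simp: in_keys_iff lookup_fundamental_cycle split: if_splits)

text \<open>Each codimension-one face lies in exactly two facets, which are exchanged by replacing the missing
  vertex with its antipode. The face enters the boundary with opposite signs, since the parity of the
  number of odd vertices changes and the position of the replaced vertex does not. The terms are split
  by the parity of the removed vertex; the reflection \<open>r\<close> exchanges the two halves, so that the
  argument is valid also in characteristic two.\<close>

lemma boundary_fundamental_cycle:
  "boundary p (fundamental_cycle p :: nat set \<Rightarrow>\<^sub>0 'k::field) = 0"
proof (cases "p = 0")
  case False
  define g :: "nat set \<times> nat \<Rightarrow> nat set \<Rightarrow>\<^sub>0 'k" where
    "g = (\<lambda>(S, v). Poly_Mapping.single (S - {v})
            ((- 1) ^ card {u \<in> S. u < v} * (- 1) ^ card {u \<in> S. odd u}))"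
  define E where "E = {(S, v). S \<in> facets p \<and> v \<in> S \<and> even v}"
  define O' where "O' = {(S, v). S \<in> facets p \<and> v \<in> S \<and> odd v}"
  define r where "r = (\<lambda>(S, v). (insert (antipode v) (S - {v}), antipode v))"
  have EO: "Sigma (facets p) (\<lambda>S. S) = E \<union> O'" "E \<inter> O' = {}"
    by (auto simp: E_def O'_def)
  have fin: "finite (Sigma (facets p) (\<lambda>S. S))"
    using finite_facets finite_facet by (rule finite_SigmaI)
  have r_r: "r (r (S, v)) = (S, v)" if "S \<in> facets p" "v \<in> S" for S v
    using that antipode_notin[OF that] by (auto simp: r_def)
  have "sum g E = (\<Sum>x\<in>O'. - g x)"
  proof (rule sum.reindex_bij_witness[of _ r r])
    fix x assume "x \<in> E"
    then obtain S v where x: "x = (S, v)" and S: "S \<in> facets p" "v \<in> S" "even v"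
      by (auto simp: E_def)
    note v' = antipode_notin[OF S(1,2)]
    have [simp]: "antipode v = v + 1" using S(3) by (simp add: antipode_def)
    show "r (r x) = x" using r_r S by (simp add: x)
    show "r x \<in> O'" using reflect_facet[OF S(1,2)] S(3) by (simp add: x r_def O'_def)
    let ?S = "insert (v + 1) (S - {v})"
    have "?S - {v + 1} = S - {v}" using v' by auto
    moreover have "{u \<in> ?S. u < v + 1} = {u \<in> S. u < v}" by auto
    moreover have "{u \<in> ?S. odd u} = insert (v + 1) {u \<in> S. odd u}" using S(3) by auto
    then have "card {u \<in> ?S. odd u} = card {u \<in> S. odd u} + 1"
      using v' finite_facet[OF S(1)] by simp
    ultimately show "- g (r x) = g x"
      by (simp add: x r_def g_def single_uminus del: insert_Diff_single)
  next
    fix x assume "x \<in> O'"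
    then obtain S v where x: "x = (S, v)" and S: "S \<in> facets p" "v \<in> S" "odd v"
      by (auto simp: O'_def)
    show "r (r x) = x" using r_r S by (simp add: x)
    show "r x \<in> E" using reflect_facet[OF S(1,2)] S(3) by (simp add: x r_def E_def)
  qed
  then have "sum g (E \<union> O') = 0"
    using fin EO by (subst sum.union_disjoint) (auto simp: sum_negf)
  moreover have "boundary p (fundamental_cycle p :: nat set \<Rightarrow>\<^sub>0 'k)
      = (\<Sum>S\<in>facets p. \<Sum>v\<in>S. g (S, v))"
    unfolding boundary_eq_sum[OF False finite_facets keys_fundamental_cycle]
    by (intro sum.cong refl) (simp add: g_def lookup_fundamental_cycle)
  moreover have "\<dots> = sum g (E \<union> O')"
    unfolding EO(1)[symmetric]
    using finite_facets finite_facet by (subst sum.Sigma) (auto intro!: sum.cong)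
  ultimately show ?thesis by simp
qed (simp add: boundary_def)

lemma lookup_fundamental_cycle_nonzero:
  "Poly_Mapping.lookup (fundamental_cycle p :: nat set \<Rightarrow>\<^sub>0 'k::field) ((\<lambda>i. 2 * i) ` {..p}) \<noteq> 0"
proof -
  \<comment> \<open>The facet of the even vertices.\<close>
  have "(\<lambda>i. 2 * i) ` {..p} \<in> facets p"
    by (auto simp: facets_def inj_on_def card_image)
  then show ?thesis by (simp add: lookup_fundamental_cycle)
qed

lemma betti_cocktail_party_pos:
  "0 < persistent_betti TYPE('k::field) p
         (clique_complex (cocktail_party_graph p)) (clique_complex (cocktail_party_graph p))"
proof -
  let ?K = "clique_complex (cocktail_party_graph p)"
  let ?z = "fundamental_cycle p :: nat set \<Rightarrow>\<^sub>0 'k"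
  have "facets p \<subseteq> {S \<in> ?K. card S = p + 1}"
    by (auto simp: facets_def clique_complex_cocktail_party)
  then have "?z \<in> carrier (cycle_space p ?K)"
    using keys_fundamental_cycle[of p, where 'k = 'k]
    by (simp add: carrier_cycle_space carrier_chain_space boundary_fundamental_cycle)
  moreover have "a = 0" if "scale a ?z = 0" for a
    using arg_cong[OF that, of "\<lambda>c. Poly_Mapping.lookup c ((\<lambda>i. 2 * i) ` {..p})"]
      lookup_fundamental_cycle_nonzero[of p, where 'k = 'k] by simp
  ultimately have "card {?z} \<le> persistent_betti TYPE('k) p ?K ?K"
    by (intro card_independent_cycles_le_betti finite_clique_complex pair_graph_cocktail_party)
      (auto dest: card_simplex_cocktail_party)
  then show ?thesis by simp
qed

lemma betti_two_points:
  "2 \<le> persistent_betti TYPE('k::field) 0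
         (clique_complex (cocktail_party_graph 0)) (clique_complex (cocktail_party_graph 0))"
proof -
  let ?K = "clique_complex (cocktail_party_graph 0)"
  let ?x = "Poly_Mapping.single {0::nat} (1::'k)" and ?y = "Poly_Mapping.single {Suc 0} (1::'k)"
  have xy: "?x \<noteq> ?y"
  proof
    assume "?x = ?y"
    then have "Poly_Mapping.lookup ?x {0} = Poly_Mapping.lookup ?y {0}" by (rule arg_cong)
    then show False by (simp add: lookup_single when_def)
  qed
  have "{?x, ?y} \<subseteq> carrier (cycle_space 0 ?K)"
    by (auto simp: carrier_cycle_space carrier_chain_space clique_complex_cocktail_party
        boundary_def)
  moreover have "\<forall>z\<in>{?x, ?y}. a z = 0" if "(\<Sum>z\<in>{?x, ?y}. scale (a z) z) = 0" for a
  proof -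
    have sum: "Poly_Mapping.single {0} (a ?x) + Poly_Mapping.single {Suc 0} (a ?y) = 0"
      using that xy by (simp add: scale_single)
    show ?thesis
      using arg_cong[OF sum, of "\<lambda>c. Poly_Mapping.lookup c {0}"]
        arg_cong[OF sum, of "\<lambda>c. Poly_Mapping.lookup c {Suc 0}"]
      by (simp add: lookup_add lookup_single)
  qed
  ultimately have "card {?x, ?y} \<le> persistent_betti TYPE('k) 0 ?K ?K"
    by (intro card_independent_cycles_le_betti finite_clique_complex pair_graph_cocktail_party)
      (auto dest: card_simplex_cocktail_party)
  then show ?thesis using xy by simp
qed

section \<open>Graphs with smaller Betti numbers\<close>

definition edgeless_graph :: "'v set \<Rightarrow> 'v pair_pre_digraph" where
  "edgeless_graph V = \<lparr> pverts = V, parcs = {} \<rparr>"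

lemma pair_graph_edgeless: "finite V \<Longrightarrow> pair_graph (edgeless_graph V)"
  by unfold_locales (auto simp: edgeless_graph_def symmetric_def intro!: symI)

lemma betti_edgeless_graph:
  fixes V :: "'v::linorder set"
  assumes "0 < p"
  shows "persistent_betti TYPE('k::field) p
           (clique_complex (edgeless_graph V)) (clique_complex (edgeless_graph V)) = 0"
proof (rule persistent_betti_eq_0)
  fix S
  assume S: "S \<in> clique_complex (edgeless_graph V)"
  then obtain v where "v \<in> S" by (auto simp: clique_complex_def)
  with S have "S = {v}" by (auto simp: clique_complex_def clique_def edgeless_graph_def)
  then show "card S \<noteq> p + 1" using assms by simp
qed simp

definition edge_graph :: "nat pair_pre_digraph" where
  "edge_graph = \<lparr> pverts = {0, 1}, parcs = {(0, 1), (1, 0)} \<rparr>"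

lemma pair_graph_edge: "pair_graph edge_graph"
  by unfold_locales (auto simp: edge_graph_def symmetric_def intro!: symI)

lemma clique_complex_edge: "clique_complex edge_graph = {{0}, {1}, {0, 1}}"
proof -
  have "clique_complex edge_graph = Pow {0, 1} - {{}}"
    by (auto simp: clique_complex_def clique_def edge_graph_def intro: finite_subset)
  then show ?thesis by (auto simp: Pow_insert)
qed

text \<open>The edge makes its two end points homologous, so the class of the point \<open>0\<close> generates.\<close>

lemma betti_edge:
  "persistent_betti TYPE('k::field) 0 (clique_complex edge_graph) (clique_complex edge_graph) \<le> 1"
proof -
  let ?K = "clique_complex edge_graph"
  let ?x = "Poly_Mapping.single {0::nat} (1::'k)"
  have K: "{S \<in> ?K. card S = 0 + 1} = {{0}, {1}}" "{S \<in> ?K. card S = 0 + 1 + 1} = {{0, 1}}"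
    unfolding clique_complex_edge by auto
  have cycles: "carrier (cycle_space 0 ?K)
      = {c :: nat set \<Rightarrow>\<^sub>0 'k. Poly_Mapping.keys c \<subseteq> {{0}, {1}}}"
    unfolding carrier_cycle_space carrier_chain_space K by (simp add: boundary_def)
  have "?x \<in> carrier (cycle_space 0 ?K)"
    unfolding cycles by simp
  moreover have "\<exists>a. c - scale a ?x \<in> boundaries 0 ?K" if "c \<in> carrier (cycle_space 0 ?K)" for c
  proof -
    have keys: "Poly_Mapping.keys c \<subseteq> {{0}, {1}}"
      using that unfolding cycles by simp
    define a b where "a = Poly_Mapping.lookup c {0}" and "b = Poly_Mapping.lookup c {1}"
    \<comment> \<open>Subtracting the boundary of \<open>?e\<close> from \<open>c\<close> moves the coefficient \<open>b\<close> from the point \<open>1\<close> to \<open>0\<close>.\<close>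
    let ?e = "Poly_Mapping.single {0::nat, 1} b"
    define g where "g v = Poly_Mapping.single ({0, 1} - {v})
        ((- 1) ^ card {u \<in> {0, 1}. u < v} * b)" for v :: nat
    have faces: "{0, 1} - {0} = {1::nat}" "{0, 1} - {1} = {0::nat}"
      "{u \<in> {0, 1}. u < (0::nat)} = {}" "{u \<in> {0, 1}. u < (1::nat)} = {0}"
      by auto
    have "boundary 1 ?e = (\<Sum>v\<in>{0, 1}. g v)"
      by (subst boundary_eq_sum[of _ "{{0, 1}}"]) (simp_all add: g_def)
    also have "\<dots> = g 0 + g 1" by simp
    also have "\<dots> = Poly_Mapping.single {1} b + Poly_Mapping.single {0} (- b)"
      unfolding g_def faces by simp
    also have "\<dots> = c - scale (a + b) ?x"
    proof (rule poly_mapping_eqI)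
      fix S
      have "Poly_Mapping.lookup c S = 0" if "S \<noteq> {0}" "S \<noteq> {1}"
        using that keys by (auto simp: in_keys_iff)
      moreover have "{1::nat} \<noteq> {0}" by simp
      ultimately show "Poly_Mapping.lookup (Poly_Mapping.single {1} b + Poly_Mapping.single {0} (- b)) S
          = Poly_Mapping.lookup (c - scale (a + b) ?x) S"
        by (cases "S = {0}"; cases "S = {1}")
          (simp_all add: a_def b_def lookup_add lookup_minus lookup_single when_def)
    qed
    finally have "c - scale (a + b) ?x = boundary (0 + 1) ?e" by simp
    moreover have "?e \<in> carrier (chain_space (0 + 1) ?K)"
      unfolding carrier_chain_space K by simp
    ultimately show ?thesis
      unfolding boundaries_def by blast
  qed
  ultimately show ?thesis
    by (rule persistent_betti_le_1[OF subset_refl])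
qed

theorem theorem1:
  fixes p :: nat
  shows "\<not> (\<exists>\<alpha>::real. \<forall>G1 G2 :: nat pair_pre_digraph.
            pair_graph G1 \<and> pair_graph G2 \<and> pverts G1 = pverts G2 \<and> pverts G1 \<noteq> {} \<longrightarrow>
            bottleneck_distance (clique_diagram TYPE('k::field) p G1) (clique_diagram TYPE('k) p G2)
              \<le> ereal (\<alpha> * graph_distance G1 G2))"
proof -
  let ?G = "cocktail_party_graph p"
  let ?H = "if p = 0 then edge_graph else edgeless_graph (pverts ?G)"
  have graphs: "pair_graph ?G" "pair_graph ?H" "pverts ?G = pverts ?H" "pverts ?G \<noteq> {}"
  proof -
    have "finite (pverts ?G)" by (simp add: cocktail_party_graph_def)
    then show "pair_graph ?H" by (simp add: pair_graph_edge pair_graph_edgeless)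
    show "pverts ?G = pverts ?H"
      by (auto simp: cocktail_party_graph_def edge_graph_def edgeless_graph_def)
    show "pverts ?G \<noteq> {}" by (auto simp: cocktail_party_graph_def)
  qed (rule pair_graph_cocktail_party)
  have "persistent_betti TYPE('k) p (clique_complex ?H) (clique_complex ?H)
      < persistent_betti TYPE('k) p (clique_complex ?G) (clique_complex ?G)"
    using betti_cocktail_party_pos[of p, where 'k = 'k] betti_edgeless_graph[of p "pverts ?G", where 'k = 'k]
      betti_two_points[where 'k = 'k] betti_edge[where 'k = 'k]
    by (cases "p = 0") auto
  then have "bottleneck_distance (clique_diagram TYPE('k) p ?G) (clique_diagram TYPE('k) p ?H) = \<infinity>"
    using graphs by (intro bottleneck_distance_infinite)
  then have "\<not> bottleneck_distance (clique_diagram TYPE('k) p ?G) (clique_diagram TYPE('k) p ?H)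
      \<le> ereal (\<alpha> * graph_distance ?G ?H)" for \<alpha>
    by simp
  then show ?thesis using graphs by blast
qed

end
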